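(* The Birkhoff polytope $B_n$, the convex hull of all $n\times n$ permutation matrices, fulfills the rhombus criterion.
   Context: A polytope $P$ with vertex set $V$ fulfills the rhombus criterion if for every pair of distinct vertices $\alpha,\beta\in V$, either $\operatorname{conv}(\alpha,\beta)$ is an edge (1-dimensional face) of $P$, or there exist $\alpha',\beta'\in V\setminus\{\alpha,\beta\}$ with $\alpha+\beta=\alpha'+\beta'$. *)

theory Defs
  imports "HOL-Analysis.Analysis"
begin

definition vertex_set :: "'a::euclidean_space set \<Rightarrow> 'a set" where
  "vertex_set P = {v. v extreme_point_of P}"

(* a' and b' are not required to be distinct. *)
definition rhombus_criterion :: "'a::euclidean_space set \<Rightarrow> bool" where
  "rhombus_criterion P \<longleftrightarrow>
     polytope P \<and>
     (\<forall>a \<in> vertex_set P. \<forall>b \<in> vertex_set P. a \<noteq> b \<longrightarrow>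
        (convex hull {a, b}) edge_of P \<or>
        (\<exists>a' \<in> vertex_set P - {a, b}. \<exists>b' \<in> vertex_set P - {a, b}. a + b = a' + b'))"

definition permutation_matrix :: "('n \<Rightarrow> 'n) \<Rightarrow> real ^ 'n ^ 'n" where
  "permutation_matrix p = (\<chi> i j. if j = p i then 1 else 0)"

(* The type 'n indexes rows and columns, so n = CARD('n). *)
definition Birkhoff_polytope :: "(real ^ 'n ^ 'n) set" where
  "Birkhoff_polytope = convex hull {permutation_matrix p | p. p permutes UNIV}"

end

theory Submission
  imports Defs
begin

text \<open>
  For permutations \<open>p\<close> and \<open>q\<close>, a linear functional counting the rows \<open>i\<close> with
  \<open>r i \<in> {p i, q i}\<close> supports the Birkhoff polytope in the face spanned by those \<open>r\<close> that choose
  one of \<open>p i\<close>, \<open>q i\<close> in every row. The complementary choices of such an \<open>r\<close> again form a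
  permutation \<open>s\<close>, and the matrices satisfy \<open>p + q = r + s\<close>. So either some \<open>r \<notin> {p, q}\<close> exists
  and yields a rhombus, or the face is the segment from \<open>p\<close> to \<open>q\<close>. For \<open>p = q\<close> the face is a
  single point, hence every permutation matrix is a vertex.
\<close>

lemma permutation_matrix_nth: "permutation_matrix p $ i $ j = (if j = p i then 1 else 0)"
  by (simp add: permutation_matrix_def)

lemma permutation_matrix_eq_iff: "permutation_matrix p = permutation_matrix q \<longleftrightarrow> p = q"
proof
  assume eq: "permutation_matrix p = permutation_matrix q"
  show "p = q"
  proof
    fix i
    have "permutation_matrix p $ i $ p i = permutation_matrix q $ i $ p i"
      using eq by simp
    then show "p i = q i"
      by (simp add: permutation_matrix_nth split: if_splits)
  qed
qed simp

lemma inner_permutation_matrix: "Z \<bullet> permutation_matrix r = (\<Sum>i\<in>UNIV. Z $ i $ r i)"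
  by (simp add: inner_vec_def permutation_matrix_nth if_distrib cong: if_cong)

lemma finite_permutation_matrices:
  "finite {permutation_matrix p | p :: 'n::finite \<Rightarrow> 'n. p permutes UNIV}"
  using finite_permutations[of "UNIV :: 'n set"] by simp

text \<open>The hyperplane cuts out a face \<open>?F\<close>, and every face of the hull of a
  compact set is the hull of some \<open>T\<close> contained in \<open>S\<close>. Since
  \<open>T\<close> lies in \<open>?F\<close>, its points lie on the hyperplane.\<close>

lemma face_of_convex_hull_finite_supporting_hyperplane_le:
  fixes S :: "'a::euclidean_space set"
  assumes "finite S" and le: "\<And>x. x \<in> S \<Longrightarrow> a \<bullet> x \<le> b"
  shows "convex hull {x \<in> S. a \<bullet> x = b} face_of convex hull S"
proof -
  let ?F = "convex hull S \<inter> {x. a \<bullet> x = b}"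
  have "convex hull S \<subseteq> {x. a \<bullet> x \<le> b}"
    by (rule hull_minimal) (auto simp: le convex_halfspace_le)
  then have face: "?F face_of convex hull S"
    by (intro face_of_Int_supporting_hyperplane_le) auto
  then obtain T where T: "T \<subseteq> S" "?F = convex hull T"
    using face_of_convex_hull_subset[OF finite_imp_compact[OF \<open>finite S\<close>]] by metis
  have "T \<subseteq> {x \<in> S. a \<bullet> x = b}"
    using T hull_subset[of T convex] by auto
  then have "?F \<subseteq> convex hull {x \<in> S. a \<bullet> x = b}"
    unfolding T(2) by (rule hull_mono)
  moreover have "convex hull {x \<in> S. a \<bullet> x = b} \<subseteq> ?F"
    by (rule hull_minimal)
      (auto simp: hull_inc intro!: convex_Int convex_hyperplane)
  ultimately show ?thesis
    using face by simp
qed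

lemma face_of_Birkhoff_polytope:
  fixes p q :: "'n::finite \<Rightarrow> 'n"
  shows "convex hull {permutation_matrix r | r. r permutes UNIV \<and> (\<forall>i. r i = p i \<or> r i = q i)}
    face_of Birkhoff_polytope"
proof -
  let ?S = "{permutation_matrix r | r :: 'n \<Rightarrow> 'n. r permutes UNIV}"
  \<comment> \<open>\<open>Z\<close> is the entrywise maximum of the matrices of \<open>p\<close>
    and \<open>q\<close>, not their sum: a row with \<open>p i = q i\<close> must count once, so
    that each row contributes at most 1.\<close>
  define Z :: "real ^ 'n ^ 'n" where "Z = (\<chi> i j. if j = p i \<or> j = q i then 1 else 0)"
  have Z: "Z \<bullet> permutation_matrix r = real (card {i. r i = p i \<or> r i = q i})" for r
    by (simp add: inner_permutation_matrix Z_def sum.If_cases)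
  have full: "Z \<bullet> permutation_matrix r = real CARD('n) \<longleftrightarrow> (\<forall>i. r i = p i \<or> r i = q i)" for r
    using card_subset_eq[of UNIV "{i. r i = p i \<or> r i = q i}"] by (auto simp: Z)
  have "convex hull {x \<in> ?S. Z \<bullet> x = real CARD('n)} face_of convex hull ?S"
    by (rule face_of_convex_hull_finite_supporting_hyperplane_le[OF finite_permutation_matrices])
      (auto simp: Z intro!: card_mono)
  moreover have "{x \<in> ?S. Z \<bullet> x = real CARD('n)} =
      {permutation_matrix r | r. r permutes UNIV \<and> (\<forall>i. r i = p i \<or> r i = q i)}"
    using full by blast
  ultimately show ?thesis
    by (simp add: Birkhoff_polytope_def)
qed

lemma vertex_set_Birkhoff_polytope:
  "vertex_set Birkhoff_polytope =
    {permutation_matrix p | p :: 'n::finite \<Rightarrow> 'n. p permutes UNIV}"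
proof
  show "vertex_set Birkhoff_polytope \<subseteq> {permutation_matrix p | p :: 'n \<Rightarrow> 'n. p permutes UNIV}"
    unfolding vertex_set_def Birkhoff_polytope_def
    using extreme_point_of_convex_hull by blast
next
  have "permutation_matrix p extreme_point_of Birkhoff_polytope"
    if "p permutes UNIV" for p :: "'n \<Rightarrow> 'n"
  proof -
    have "{permutation_matrix r | r. r permutes UNIV \<and> (\<forall>i. r i = p i \<or> r i = p i)} =
        {permutation_matrix p}"
      using that by (auto intro: arg_cong[of _ _ permutation_matrix])
    then show ?thesis
      using face_of_Birkhoff_polytope[of p p] by (simp add: face_of_singleton)
  qed
  then show "{permutation_matrix p | p :: 'n \<Rightarrow> 'n. p permutes UNIV} \<subseteq> vertex_set Birkhoff_polytope"
    by (auto simp: vertex_set_def)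
qed

text \<open>On a finite type injectivity suffices. Two rows that both take their value from
  \<open>p\<close>, or both from \<open>q\<close>, cannot collide unless equal, so only a collision
  of \<open>q i\<close> with \<open>p j\<close> needs an argument.\<close>

lemma permutes_complementary_choice:
  fixes p q r :: "'n::finite \<Rightarrow> 'n"
  assumes "p permutes UNIV" "q permutes UNIV" "r permutes UNIV"
    and choice: "\<And>i. r i = p i \<or> r i = q i"
  shows "(\<lambda>i. if r i = p i then q i else p i) permutes UNIV"
proof -
  have inj: "inj p" "inj q" "inj r" and "surj r"
    using assms by (auto dest: permutes_inj permutes_surj)
  \<comment> \<open>The row \<open>l\<close> in which \<open>r\<close> attains the common value
    \<open>q i = p j\<close> decides: if \<open>r l = p l\<close>, then \<open>l = j\<close>,
    against \<open>r j \<noteq> p j\<close>; if \<open>r l = q l\<close>, then \<open>l = i\<close>,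
    so \<open>p i = r i = p j\<close>.\<close>
  have mixed: "i = j" if "r i = p i" "r j \<noteq> p j" "q i = p j" for i j
  proof -
    obtain l where l: "r l = q i"
      using \<open>surj r\<close> by (metis surjD)
    consider "p l = p j" | "q l = q i"
      using choice[of l] l \<open>q i = p j\<close> by auto
    then show ?thesis
    proof cases
      case 1
      then have "l = j"
        using inj by (simp add: inj_eq)
      then show ?thesis
        using l that by simp
    next
      case 2
      then have "l = i"
        using inj by (simp add: inj_eq)
      then show ?thesis
        using l that inj by (simp add: inj_eq)
    qed
  qed
  have "inj (\<lambda>i. if r i = p i then q i else p i)"
  proof (rule injI)
    fix i j
    assume "(if r i = p i then q i else p i) = (if r j = p j then q j else p j)"
    then consider "q i = q j" | "p i = p j" | "r i = p i" "r j \<noteq> p j" "q i = p j"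
      | "r j = p j" "r i \<noteq> p i" "q j = p i"
      by (metis (full_types))
    then show "i = j"
    proof cases
      case 3
      then show ?thesis by (rule mixed)
    next
      case 4
      then show ?thesis by (rule mixed[symmetric])
    qed (use inj in \<open>simp_all add: inj_eq\<close>)
  qed
  then show ?thesis
    by (intro bij_imp_permutes bijI finite_UNIV_inj_surj) simp_all
qed

text \<open>In each row the two complementary choices are \<open>p i\<close> and \<open>q i\<close>
  in some order.\<close>

lemma permutation_matrix_add_complementary_choice:
  assumes "\<And>i. r i = p i \<or> r i = q i"
  shows "permutation_matrix p + permutation_matrix q =
    permutation_matrix r + permutation_matrix (\<lambda>i. if r i = p i then q i else p i)"
proof -
  have "(if j = p i then 1 else 0) + (if j = q i then 1 else 0) =
      (if j = r i then 1 else 0) + (if j = (if r i = p i then q i else p i) then 1 else 0 :: real)"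
    for i j
    using assms[of i] by (cases "r i = p i") simp_all
  then show ?thesis
    by (simp add: vec_eq_iff permutation_matrix_nth)
qed

theorem proposition4p2:
  shows "rhombus_criterion (Birkhoff_polytope :: (real ^ 'n ^ 'n) set)"
  unfolding rhombus_criterion_def
proof (intro conjI ballI impI)
  show "polytope (Birkhoff_polytope :: (real ^ 'n ^ 'n) set)"
    unfolding Birkhoff_polytope_def polytope_def using finite_permutation_matrices by blast
next
  let ?V = "vertex_set (Birkhoff_polytope :: (real ^ 'n ^ 'n) set)"
  fix a b :: "real ^ 'n ^ 'n"
  assume "a \<in> ?V" "b \<in> ?V" "a \<noteq> b"
  then obtain p q where p: "p permutes UNIV" "a = permutation_matrix p"
    and q: "q permutes UNIV" "b = permutation_matrix q"
    by (auto simp: vertex_set_Birkhoff_polytope)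
  show "convex hull {a, b} edge_of Birkhoff_polytope \<or>
    (\<exists>a'\<in>?V - {a, b}. \<exists>b'\<in>?V - {a, b}. a + b = a' + b')"
  proof (cases "\<exists>r. r permutes UNIV \<and> (\<forall>i. r i = p i \<or> r i = q i) \<and> r \<noteq> p \<and> r \<noteq> q")
    case True
    then obtain r where r: "r permutes UNIV" "\<And>i. r i = p i \<or> r i = q i" "r \<noteq> p" "r \<noteq> q"
      by blast
    define s where "s = (\<lambda>i. if r i = p i then q i else p i)"
    have "s permutes UNIV"
      unfolding s_def using p(1) q(1) r(1,2) by (rule permutes_complementary_choice)
    moreover have sum: "a + b = permutation_matrix r + permutation_matrix s"
      unfolding p(2) q(2) s_def using r(2) by (rule permutation_matrix_add_complementary_choice)
    moreover have ra: "permutation_matrix r \<noteq> a" and rb: "permutation_matrix r \<noteq> b"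
      using r(3,4) by (simp_all add: p(2) q(2) permutation_matrix_eq_iff)
    \<comment> \<open>Cancelling \<open>a\<close> in \<open>sum\<close> would leave
      \<open>b = permutation_matrix r\<close>.\<close>
    moreover have "permutation_matrix s \<noteq> a"
      using sum rb by (auto simp: add.commute)
    moreover have "permutation_matrix s \<noteq> b"
      using sum ra by auto
    ultimately show ?thesis
      using r(1) unfolding vertex_set_Birkhoff_polytope by blast
  next
    case False
    \<comment> \<open>Both \<open>p\<close> and \<open>q\<close> are admissible choices themselves,
      and by assumption there are no others.\<close>
    then have "{permutation_matrix r | r. r permutes UNIV \<and> (\<forall>i. r i = p i \<or> r i = q i)} = {a, b}"
      using p q by auto
    then have "convex hull {a, b} face_of Birkhoff_polytope"
      using face_of_Birkhoff_polytope[of p q] by simp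
    moreover have "aff_dim (convex hull {a, b}) = 1"
      using \<open>a \<noteq> b\<close> by (simp add: aff_dim_convex_hull)
    ultimately show ?thesis
      by (simp add: edge_of_def)
  qed
qed

end
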